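(* There exist positive constants $C_1,C_2$ such that for all $T\ge2$, $$C_1<\frac{\sum_{1\le n\le T}f(n)}{T\log^3T}<C_2.$$
   Context: For a positive integer $n$, consider the equation $$n=\left(X+\frac1x\right)\left(Y+\frac1y\right)$$ in positive integers $X,x,Y,y$ with $x>1$ and $y>1$. Two solutions obtained from each other by transposing the pairs $(X,x)$ and $(Y,y)$ are identified, and $f(n)$ denotes the number of solutions up to this identification (so $f(1)=0$). Since $x\neq y$ in every solution, $f(n)$ is equivalently the number of quadruples $(X,x,Y,y)$ of positive integers satisfying the equation with $1<x<y$. $\log$ is the natural logarithm and $\log^3T=(\log T)^3$. *)

theory Defs
  imports Complex_Main
begin

definition sols :: "nat \<Rightarrow> ((nat \<times> nat) \<times> (nat \<times> nat)) set" where
  "sols n = {((X, x), (Y, y)).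
     X > 0 \<and> x > 1 \<and> Y > 0 \<and> y > 1 \<and>
     real n = (real X + 1 / real x) * (real Y + 1 / real y)}"

text \<open>\<open>prod.swap\<close> transposes the pairs \<open>(X, x)\<close> and \<open>(Y, y)\<close>.\<close>

definition transp_rel :: "nat \<Rightarrow> (((nat \<times> nat) \<times> (nat \<times> nat)) \<times> ((nat \<times> nat) \<times> (nat \<times> nat))) set" where
  "transp_rel n = {(p, q). p \<in> sols n \<and> q \<in> sols n \<and> (q = p \<or> q = prod.swap p)}"

definition num_sols :: "nat \<Rightarrow> nat" where
  "num_sols n = card (sols n // transp_rel n)"

text \<open>Each \<open>sols n\<close> is finite (\<open>finite_sols\<close> below), so \<open>card\<close> is a genuine count.\<close>

lemma swap_sols: "p \<in> sols n \<Longrightarrow> prod.swap p \<in> sols n"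
  by (auto simp: sols_def mult.commute)

lemma equiv_transp_rel: "equiv (sols n) (transp_rel n)"
  by (rule equivI) (auto simp: transp_rel_def refl_on_def sym_def trans_def)

lemma sols_nat_eq:
  assumes "((X, x), (Y, y)) \<in> sols n"
  shows "n * (x * y) = (X * x + 1) * (Y * y + 1)"
proof -
  have x: "x > 1" and y: "y > 1" and eq: "real n = (real X + 1 / real x) * (real Y + 1 / real y)"
    using assms by (auto simp: sols_def)
  from eq x y have "real n * (real x * real y) = (real X * real x + 1) * (real Y * real y + 1)"
    by (simp add: field_simps)
  then have "real (n * (x * y)) = real ((X * x + 1) * (Y * y + 1))"
    by (simp only: of_nat_mult of_nat_add of_nat_1)
  then show ?thesis
    by (simp only: of_nat_eq_iff)
qed

lemma sols_bound:
  assumes s: "((X, x), (Y, y)) \<in> sols n"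
  shows "X \<le> n \<and> x \<le> 2 * n"
proof -
  have pos: "X > 0" "x > 1" "Y > 0" "y > 1"
    using s by (auto simp: sols_def)
  note eq = sols_nat_eq[OF s]
  have "coprime y (Y * y + 1)"
    by (metis coprime_1_right coprime_iff_gcd_eq_1 gcd_add_mult add.commute)
  moreover have "y dvd (X * x + 1) * (Y * y + 1)"
    using eq by (metis dvd_triv_right mult.assoc)
  ultimately have "y dvd X * x + 1"
    using coprime_dvd_mult_left_iff by blast
  then obtain k where k: "X * x + 1 = y * k" by (rule dvdE)
  have "y * (n * x) = y * (k * (Y * y + 1))"
    using eq unfolding k by (simp only: ac_simps)
  then have nx: "n * x = k * (Y * y + 1)"
    using pos by simp
  also have "\<dots> = Y * (y * k) + k"
    by (simp add: algebra_simps)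
  also have "\<dots> = Y * X * x + Y + k"
    unfolding k[symmetric] by (simp add: algebra_simps)
  finally have e: "n * x = Y * X * x + (Y + k)" by simp
  then have "Y * X * x < n * x" using pos by simp
  then have lt: "Y * X < n" by simp
  have "Y * 1 \<le> Y * X" "1 * X \<le> Y * X"
    using pos by (intro mult_le_mono; simp)+
  then have Yn: "Y \<le> n" and Xn: "X \<le> n" using lt by linarith+
  have "x dvd k * (Y * y + 1)"
    using nx by (metis dvd_triv_right)
  moreover have "coprime x k"
  proof -
    have "coprime x (X * x + 1)"
      by (metis coprime_1_right coprime_iff_gcd_eq_1 gcd_add_mult add.commute)
    then show ?thesis unfolding k by simp
  qed
  ultimately have "x dvd Y * y + 1"
    using coprime_dvd_mult_right_iff by blast
  then obtain l where l: "Y * y + 1 = x * l" by (rule dvdE)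
  have "x * n = x * (k * l)"
    using nx unfolding l by (simp only: ac_simps)
  then have "n = k * l" using pos by simp
  moreover have "l > 0" using l by (cases l) auto
  ultimately have kn: "k \<le> n" by simp
  obtain d where d: "n = Y * X + Suc d"
    using lt less_iff_Suc_add by auto
  have "Suc d * x = Y + k"
    using e unfolding d by (simp only: add_mult_distrib)
  then have "x \<le> Y + k" by (metis le_add1 mult_Suc)
  then show ?thesis using Xn Yn kn by simp
qed

lemma finite_sols: "finite (sols n)"
proof (rule finite_subset)
  show "sols n \<subseteq> ({..n} \<times> {..2 * n}) \<times> ({..n} \<times> {..2 * n})"
  proof
    fix p assume p: "p \<in> sols n"
    obtain X x Y y where pe: "p = ((X, x), (Y, y))" by (cases p) auto
    have "((Y, y), (X, x)) \<in> sols n"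
      using swap_sols[OF p] pe by simp
    then show "p \<in> ({..n} \<times> {..2 * n}) \<times> ({..n} \<times> {..2 * n})"
      using sols_bound[of X x Y y n] sols_bound[of Y y X x n] p pe by auto
  qed
qed simp

lemma sols_neq:
  assumes "((X, x), (Y, y)) \<in> sols n"
  shows "x \<noteq> y"
proof
  assume xy: "x = y"
  have x: "x > 1"
    using assms by (auto simp: sols_def)
  have "n * (x * x) = (X * x + 1) * (Y * x + 1)"
    using sols_nat_eq[OF assms] xy by simp
  also have "\<dots> = x * (X * (Y * x) + X + Y) + 1"
    by (simp add: algebra_simps)
  finally have "x dvd x * (X * (Y * x) + X + Y) + 1"
    by (metis dvd_triv_right mult.assoc)
  then have "x dvd 1"
    using dvd_add_right_iff[of x "x * (X * (Y * x) + X + Y)" 1] by simp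
  with x show False by simp
qed

lemma num_sols_eq_card_ordered:
  "num_sols n = card {((X, x), (Y, y)). ((X, x), (Y, y)) \<in> sols n \<and> x < y}"
proof -
  let ?O = "{((X, x), (Y, y)). ((X, x), (Y, y)) \<in> sols n \<and> x < y}"
  let ?c = "\<lambda>p. transp_rel n `` {p}"
  have O: "p \<in> sols n \<and> snd (fst p) < snd (snd p)" if "p \<in> ?O" for p
    using that by auto
  have "inj_on ?c ?O"
  proof (rule inj_onI)
    fix p q assume p: "p \<in> ?O" and q: "q \<in> ?O" and "?c p = ?c q"
    then have "(p, q) \<in> transp_rel n"
      using eq_equiv_class_iff[OF equiv_transp_rel] O[OF p] O[OF q] by blast
    then show "p = q"
      using O[OF p] O[OF q] by (auto simp: transp_rel_def)
  qed
  moreover have "?c ` ?O = sols n // transp_rel n"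
  proof
    show "?c ` ?O \<subseteq> sols n // transp_rel n"
    proof
      fix A assume "A \<in> ?c ` ?O"
      then obtain p where "p \<in> ?O" and A: "A = ?c p"
        by (rule imageE)
      then have "p \<in> sols n" using O by blast
      then show "A \<in> sols n // transp_rel n"
        unfolding A by (rule quotientI)
    qed
    show "sols n // transp_rel n \<subseteq> ?c ` ?O"
    proof
      fix A assume "A \<in> sols n // transp_rel n"
      then obtain p where p: "p \<in> sols n" and A: "A = ?c p"
        by (rule quotientE)
      obtain X x Y y where pe: "p = ((X, x), (Y, y))" by (cases p) auto
      have "?c p = ?c (prod.swap p)"
        using p swap_sols[OF p]
        by (intro equiv_class_eq[OF equiv_transp_rel]) (auto simp: transp_rel_def)
      moreover have "x < y \<or> y < x"
        using sols_neq[of X x Y y n] p pe by (simp add: nat_neq_iff)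
      then have "p \<in> ?O \<or> prod.swap p \<in> ?O"
        using p swap_sols[OF p] pe by auto
      ultimately show "A \<in> ?c ` ?O"
        using A by (metis (no_types, lifting) image_eqI)
    qed
  qed
  ultimately show ?thesis
    using card_image[of ?c ?O] by (simp only: num_sols_def)
qed

end

theory Submission
  imports Defs "HOL-Analysis.Harmonic_Numbers" "HOL-Number_Theory.Cong"
begin

text \<open>
  In a solution, \<open>y\<close> divides \<open>X * x + 1\<close> and \<open>x\<close> divides \<open>Y * y + 1\<close>. Writing
  \<open>X * x + 1 = k * y\<close> and \<open>Y * y + 1 = l * x\<close> gives \<open>n = k * l\<close>, so the sum counts the
  quadruples \<open>(x, y, k, l)\<close> with \<open>k\<close> inverse to \<open>y\<close> modulo \<open>x\<close>, \<open>l\<close> inverse to \<open>x\<close> modulo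
  \<open>y\<close>, and \<open>k * l \<le> T\<close>. For coprime \<open>x\<close> and \<open>y\<close>, a solution is determined by
  \<open>k div x\<close> and \<open>l div y\<close>.

  Lower bound: \<open>k \<le> x * s\<close> and \<open>l \<le> y * t\<close> whenever \<open>k div x = s - 1\<close> and
  \<open>l div y = t - 1\<close>, so every \<open>(x, y, s, t)\<close> with \<open>x\<close>, \<open>y\<close> coprime and
  \<open>x * y * s * t \<le> T\<close> yields a solution.

  Upper bound: solutions with \<open>k \<ge> x\<close> and \<open>l \<ge> y\<close> inject into
  \<open>{(a, b, c, d). a * b * c * d \<le> T}\<close>. If \<open>k < x\<close> or \<open>l < y\<close>, then, up to exchanging
  the roles of \<open>x\<close> and \<open>y\<close>, the solution gives
  \<open>(x, y, k, t)\<close> with \<open>x\<close> dividing \<open>k * y - 1\<close> and \<open>k * y * t \<le> 2 * T\<close>; replacing each of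
  the divisors \<open>k\<close> of \<open>k * y\<close> and \<open>x\<close> of \<open>k * y - 1\<close> by the smaller member of its
  complementary pair leads again, at most four to one, to quadruples of bounded product.
\<close>

section \<open>Quadruples of bounded product\<close>

definition bounded_quads :: "nat \<Rightarrow> (nat \<times> nat \<times> nat \<times> nat) set" where
  "bounded_quads N = {(a, b, c, d). a > 0 \<and> b > 0 \<and> c > 0 \<and> d > 0 \<and> a * b * c * d \<le> N}"

text \<open>For fixed \<open>a\<close>, \<open>b\<close>, \<open>c\<close> the admissible
  \<open>d\<close> form an interval, which turns the count into a triple sum of quotients.\<close>

lemma bounded_quads_Sigma:
  "bounded_quads N =
     (\<lambda>((a, b, c), d). (a, b, c, d)) `
       (SIGMA (a, b, c) : {1..N} \<times> {1..N} \<times> {1..N}. {1..N div (a * b * c)})"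
proof (intro equalityI subsetI)
  fix p assume "p \<in> bounded_quads N"
  then obtain a b c d where p: "p = (a, b, c, d)"
    and pos: "a > 0" "b > 0" "c > 0" "d > 0" and le: "a * b * c * d \<le> N"
    by (auto simp: bounded_quads_def)
  have "a dvd a * b * c * d" "b dvd a * b * c * d" "c dvd a * b * c * d"
    by (auto simp: mult_ac)
  moreover have "0 < a * b * c * d" using pos by simp
  ultimately have "a \<le> N" "b \<le> N" "c \<le> N"
    using le dvd_imp_le order_trans by blast+
  moreover have "d \<le> N div (a * b * c)"
    using le pos by (simp add: less_eq_div_iff_mult_less_eq mult_ac)
  ultimately show "p \<in> (\<lambda>((a, b, c), d). (a, b, c, d)) `
      (SIGMA (a, b, c) : {1..N} \<times> {1..N} \<times> {1..N}. {1..N div (a * b * c)})"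
    using pos unfolding p by (intro image_eqI[of _ _ "((a, b, c), d)"]) auto
next
  fix p assume "p \<in> (\<lambda>((a, b, c), d). (a, b, c, d)) `
      (SIGMA (a, b, c) : {1..N} \<times> {1..N} \<times> {1..N}. {1..N div (a * b * c)})"
  then show "p \<in> bounded_quads N"
    by (auto simp: bounded_quads_def less_eq_div_iff_mult_less_eq mult_ac)
qed

lemma finite_bounded_quads: "finite (bounded_quads N)"
  unfolding bounded_quads_Sigma by (intro finite_imageI finite_SigmaI) auto

text \<open>Once the rounding in \<open>N div (a * b * c)\<close> is dropped, the triple sum factors
  into three harmonic sums.\<close>

lemma card_bounded_quads_le: "real (card (bounded_quads N)) \<le> real N * harm N ^ 3"
proof -
  let ?I = "{1..N} \<times> {1..N} \<times> {1..N}"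
  have "card (bounded_quads N) \<le> card (SIGMA (a, b, c) : ?I. {1..N div (a * b * c)})"
    unfolding bounded_quads_Sigma by (intro card_image_le finite_SigmaI) auto
  also have "\<dots> = (\<Sum>(a, b, c)\<in>?I. N div (a * b * c))"
    by (subst card_SigmaI) (auto intro!: sum.cong)
  finally have "real (card (bounded_quads N)) \<le> (\<Sum>(a, b, c)\<in>?I. real (N div (a * b * c)))"
    by (simp add: case_prod_unfold flip: of_nat_sum)
  also have "\<dots> \<le> (\<Sum>(a, b, c)\<in>?I. real N / (real a * real b * real c))"
    using of_nat_div_le_of_nat by (intro sum_mono) (force simp: simp flip: of_nat_mult)
  also have "\<dots> = real N * (harm N * (harm N * harm N))"
    by (simp add: harm_def sum_product sum_distrib_left sum_distrib_right
        flip: sum.cartesian_product) (simp add: field_simps)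
  finally show ?thesis by (simp add: power3_eq_cube mult_ac)
qed

text \<open>The sequence \<open>harm n - ln n\<close> is decreasing and starts at 1.\<close>

lemma harm_le_ln:
  assumes "n > 0" shows "harm n \<le> 1 + ln (real n)"
  using euler_mascheroni_sequence_decreasing[of 1 n] assms by (simp add: harm_expand)

section \<open>Modular inverses and the two auxiliary families\<close>

lemma cong_div_eqD:
  fixes a b m :: nat
  assumes "[a = b] (mod m)" "a div m = b div m" shows "a = b"
  using assms by (metis cong_def div_mult_mod_eq)

lemma cong_inverse_unique:
  fixes k k' x y :: nat
  assumes "[k * y = 1] (mod x)" "[k' * y = 1] (mod x)"
  shows "[k = k'] (mod x)"
proof -
  have "coprime y x"
    using assms(1) by (metis coprime_iff_invertible_nat mult.commute One_nat_def)
  then show ?thesis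
    using assms by (metis cong_mult_rcancel_nat cong_sym cong_trans)
qed

text \<open>The congruences already force \<open>x\<close> and \<open>y\<close> to be coprime and
  \<open>k\<close> and \<open>l\<close> to be positive.\<close>

definition inverse_quads :: "nat \<Rightarrow> (nat \<times> nat \<times> nat \<times> nat) set" where
  "inverse_quads N = {(x, y, k, l). x > 1 \<and> y > 1 \<and> k * l \<le> N \<and>
     [k * y = 1] (mod x) \<and> [l * x = 1] (mod y)}"

text \<open>With \<open>m = k * y\<close>, this encodes the sum over \<open>m > 1\<close> of
  \<open>d(m) * d(m - 1) * (N div m)\<close>, where \<open>d\<close> counts divisors:
  \<open>k\<close> divides \<open>m\<close> and \<open>x\<close> divides
  \<open>m - 1\<close>.\<close>

definition divisor_quads :: "nat \<Rightarrow> (nat \<times> nat \<times> nat \<times> nat) set" where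
  "divisor_quads N = {(x, y, k, t). x > 0 \<and> t > 0 \<and> k * y > 1 \<and> k * y * t \<le> N \<and>
     [k * y = 1] (mod x)}"

text \<open>The smaller divisors \<open>a\<close> and \<open>b\<close> satisfy \<open>a * b \<le> k * y\<close> and are coprime, so
  \<open>k * y\<close> can be recovered from its residue \<open>0\<close> modulo \<open>a\<close>, its residue \<open>1\<close> modulo \<open>b\<close> and
  its quotient by \<open>a * b\<close>. The two booleans record which member of each pair is the smaller.\<close>

lemma finite_divisor_quads: "finite (divisor_quads N)"
  and card_divisor_quads_le: "card (divisor_quads N) \<le> 4 * card (bounded_quads N)"
proof -
  define a where "a = (\<lambda>y k :: nat. min k y)"
  define b where "b = (\<lambda>x y k :: nat. min x ((k * y - 1) div x))"
  define F where "F = (\<lambda>(x, y, k, t). (k \<le> y, x \<le> (k * y - 1) div x,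
    (a y k, b x y k, (k * y) div (a y k * b x y k), t :: nat)))"
  let ?R = "(UNIV :: bool set) \<times> (UNIV :: bool set) \<times> bounded_quads N"
  have key: "\<exists>X. k * y = X * x + 1 \<and> X > 0 \<and> (k * y - 1) div x = X \<and>
       b x y k dvd (k * y - 1) \<and> a y k dvd k * y \<and> coprime (a y k) (b x y k) \<and>
       a y k > 0 \<and> b x y k > 0 \<and> a y k * b x y k \<le> k * y"
    if "(x, y, k, t) \<in> divisor_quads N" for x y k t
  proof -
    have *: "x > 0" "t > 0" "k * y > 1" "[k * y = 1] (mod x)"
      using that by (auto simp: divisor_quads_def)
    then obtain X where X: "k * y = X * x + 1"
      using cong_le_nat[of 1 "k * y" x] by (metis less_imp_le)
    have Xdiv: "(k * y - 1) div x = X" using X * by simp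
    have X0: "X > 0" using X * by (cases X) auto
    have bd: "b x y k dvd (k * y - 1)"
      unfolding b_def Xdiv using X by (auto simp: min_def)
    have ad: "a y k dvd k * y" by (auto simp: a_def min_def)
    have "coprime (k * y) (k * y - 1)"
      using * by (metis coprime_diff_one_left_nat coprime_commute gr_implies_not_zero not_gr_zero)
    then have cop: "coprime (a y k) (b x y k)"
      using ad bd by (meson coprime_divisors)
    \<comment> \<open>The smaller of two complementary divisors has square at most their product;
      the larger of the two squares then bounds \<open>a * b\<close>.\<close>
    have "a y k * a y k \<le> k * y" by (auto simp: a_def min_def mult_le_mono)
    moreover have "b x y k * b x y k \<le> k * y - 1"
      unfolding b_def Xdiv using X by (auto simp: min_def mult_le_mono)
    ultimately have "a y k * b x y k \<le> k * y"
      by (metis diff_le_self le_trans mult_le_mono nat_le_linear order_refl)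
    moreover have "k > 0" "y > 0" using *(3) by (auto intro!: gr0I)
    ultimately show ?thesis using X Xdiv X0 bd ad cop * by (auto simp: a_def b_def)
  qed
  have sub: "F ` divisor_quads N \<subseteq> ?R"
  proof (intro subsetI, elim imageE)
    fix p q assume "q \<in> divisor_quads N" and p: "p = F q"
    then obtain x y k t where q: "q = (x, y, k, t)" and m: "(x, y, k, t) \<in> divisor_quads N"
      by (cases q) auto
    have t: "t > 0" "k * y * t \<le> N" using m by (auto simp: divisor_quads_def)
    have X: "a y k > 0" "b x y k > 0" "a y k * b x y k \<le> k * y"
      using key[OF m] by blast+
    \<comment> \<open>Rounding the quotient down only shrinks the product of the four
      entries.\<close>
    have "a y k * b x y k * (k * y div (a y k * b x y k)) \<le> k * y"
      by simp
    then have "a y k * b x y k * (k * y div (a y k * b x y k)) * t \<le> N"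
      using t by (meson le_trans mult_le_mono1)
    moreover have "k * y div (a y k * b x y k) > 0"
      using X by (simp add: div_greater_zero_iff)
    ultimately show "p \<in> ?R"
      using X t unfolding p q F_def by (simp add: bounded_quads_def)
  qed
  have inj: "inj_on F (divisor_quads N)"
  proof (rule inj_onI)
    fix p q assume p: "p \<in> divisor_quads N" and q: "q \<in> divisor_quads N" and e: "F p = F q"
    obtain x y k t x' y' k' t' where pe: "p = (x, y, k, t)" and qe: "q = (x', y', k', t')"
      by (cases p, cases q) auto
    obtain X where X: "k * y = X * x + 1" "X > 0" "(k * y - 1) div x = X"
       "b x y k dvd (k * y - 1)" "a y k dvd k * y" "coprime (a y k) (b x y k)"
      using key p pe by blast
    obtain X' where X': "k' * y' = X' * x' + 1" "X' > 0" "(k' * y' - 1) div x' = X'"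
       "b x' y' k' dvd (k' * y' - 1)" "a y' k' dvd k' * y'"
      using key q qe by blast
    have e: "(k \<le> y) = (k' \<le> y')" "(x \<le> X) = (x' \<le> X')" "a y k = a y' k'" "b x y k = b x' y' k'"
      "k * y div (a y k * b x y k) = k' * y' div (a y' k' * b x' y' k')" "t = t'"
      using e unfolding pe qe F_def X(3)[symmetric] X'(3)[symmetric] by auto
    have 1: "[k * y = k' * y'] (mod a y k)"
      using X X' e by (simp add: cong_def mod_eq_0_iff_dvd)
    have "[k * y = 1] (mod b x y k)" "[k' * y' = 1] (mod b x y k)"
      using X X' e by (auto simp: cong_altdef_nat)
    then have "[k * y = k' * y'] (mod b x y k)"
      by (metis cong_sym cong_trans)
    with 1 have "[k * y = k' * y'] (mod a y k * b x y k)"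
      using X(6) coprime_cong_mult_nat by blast
    then have ky: "k * y = k' * y'"
      by (rule cong_div_eqD) (use e in simp)
    have "1 < k * y" "1 < k' * y'" using p q pe qe by (auto simp: divisor_quads_def)
    then have "0 < k * y" "0 < k' * y'" by linarith+
    \<comment> \<open>The product and its smaller factor give the larger factor, and the boolean
      tells which is \<open>k\<close>. The same argument recovers \<open>x\<close> from
      \<open>X * x\<close>.\<close>
    then have "k = k' \<and> y = y'"
      using e(1,3) ky by (auto simp: a_def min_def split: if_splits)
    moreover have Xx: "X * x = X' * x'" using X X' ky by simp
    have "x > 0" "x' > 0" using p q pe qe by (auto simp: divisor_quads_def)
    then have "x = x'"
      using e(2,4) X(2,3) X'(2,3) Xx unfolding b_def X(3) X'(3)
      by (auto simp: min_def split: if_splits)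
    ultimately show "p = q" using pe qe e by simp
  qed
  have fin: "finite ?R" using finite_bounded_quads by simp
  show "finite (divisor_quads N)"
    using inj_on_finite[OF inj sub fin] .
  show "card (divisor_quads N) \<le> 4 * card (bounded_quads N)"
    using card_inj_on_le[OF inj sub fin] by (simp add: card_cartesian_product)
qed

section \<open>Upper bound for the inverse quadruples\<close>

lemma inverse_quads_swap:
  "(x, y, k, l) \<in> inverse_quads N \<Longrightarrow> (y, x, l, k) \<in> inverse_quads N"
  by (simp add: inverse_quads_def mult.commute)

lemma inverse_quads_pos:
  assumes "(x, y, k, l) \<in> inverse_quads N"
  shows "x > 1" "y > 1" "k > 0" "l > 0"
proof -
  have *: "x > 1" "y > 1" "[k * y = 1] (mod x)" "[l * x = 1] (mod y)"
    using assms by (auto simp: inverse_quads_def)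
  then show "x > 1" "y > 1" by simp_all
  show "k > 0" "l > 0" using * by (auto intro!: gr0I simp: cong_0_1_nat')
qed

text \<open>Given \<open>x\<close> and \<open>y\<close>, the congruences fix \<open>k\<close> modulo
  \<open>x\<close> and \<open>l\<close> modulo \<open>y\<close>, so only the two quotients have to
  be recovered.\<close>

lemma inj_on_inverse_quads:
  assumes "A \<subseteq> inverse_quads N"
    and "\<And>x y k l x' y' k' l'. F (x, y, k, l) = F (x', y', k', l') \<Longrightarrow>
       (x, y, k, l) \<in> A \<Longrightarrow> (x', y', k', l') \<in> A \<Longrightarrow>
       x = x' \<and> y = y' \<and> k div x = k' div x' \<and> l div y = l' div y'"
  shows "inj_on F A"
proof (rule inj_onI)
  fix p q assume pq: "p \<in> A" "q \<in> A" and F: "F p = F q"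
  obtain x y k l x' y' k' l' where p: "p = (x, y, k, l)" and q: "q = (x', y', k', l')"
    by (cases p, cases q) auto
  have e: "x = x'" "y = y'" "k div x = k' div x'" "l div y = l' div y'"
    using assms(2)[of x y k l x' y' k' l'] F pq unfolding p q by auto
  have "[k * y = 1] (mod x)" "[l * x = 1] (mod y)" "[k' * y = 1] (mod x)" "[l' * x = 1] (mod y)"
    using pq assms(1) e unfolding p q inverse_quads_def by auto
  then have "k = k'" "l = l'"
    using e cong_div_eqD cong_inverse_unique by metis+
  with e show "p = q" using p q by simp
qed

text \<open>Here both quotients are positive, and \<open>x * (k div x) \<le> k\<close>,
  \<open>y * (l div y) \<le> l\<close> keep the product below \<open>N\<close>.\<close>

lemma large_inverse_quads:
  shows "finite {(x, y, k, l) \<in> inverse_quads N. x \<le> k \<and> y \<le> l}" (is "finite ?A")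
    and "card {(x, y, k, l) \<in> inverse_quads N. x \<le> k \<and> y \<le> l} \<le> card (bounded_quads N)"
proof -
  let ?F = "\<lambda>(x, y, k, l). (x, y, k div x, l div y) :: nat \<times> nat \<times> nat \<times> nat"
  have inj: "inj_on ?F ?A"
    by (rule inj_on_inverse_quads[where N = N]) auto
  have "x * y * (k div x) * (l div y) \<le> N" if "k * l \<le> N" for x y k l :: nat
  proof -
    have "x * y * (k div x) * (l div y) = (x * (k div x)) * (y * (l div y))"
      by (simp add: mult_ac)
    also have "\<dots> \<le> k * l" by (intro mult_le_mono) auto
    finally show ?thesis using that by simp
  qed
  then have sub: "?F ` ?A \<subseteq> bounded_quads N"
    by (auto simp: bounded_quads_def inverse_quads_def div_greater_zero_iff)
  note fin = finite_bounded_quads[of "N"]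
  show "finite ?A" by (rule inj_on_finite[OF inj sub fin])
  show "card ?A \<le> card (bounded_quads N)" by (rule card_inj_on_le[OF inj sub fin])
qed

text \<open>Since \<open>k div x = 0\<close>, the entry \<open>k\<close> itself is kept and only
  \<open>l\<close> is replaced by its quotient; the congruence for \<open>k\<close> becomes the
  divisor condition.\<close>

lemma mixed_inverse_quads:
  shows "finite {(x, y, k, l) \<in> inverse_quads N. k < x \<and> y \<le> l}" (is "finite ?A")
    and "card {(x, y, k, l) \<in> inverse_quads N. k < x \<and> y \<le> l} \<le> card (divisor_quads N)"
proof -
  let ?F = "\<lambda>(x, y, k, l). (x, y, k, l div y) :: nat \<times> nat \<times> nat \<times> nat"
  have inj: "inj_on ?F ?A"
    by (rule inj_on_inverse_quads[where N = N]) auto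
  have sub: "?F ` ?A \<subseteq> divisor_quads N"
  proof clarify
    fix x y k l assume m: "(x, y, k, l) \<in> inverse_quads N" and "k < x" "y \<le> l"
    note pos = inverse_quads_pos[OF m]
    have "k * y * (l div y) = k * (y * (l div y))" by (simp add: mult_ac)
    also have "\<dots> \<le> k * l" by (intro mult_le_mono) auto
    also have "\<dots> \<le> N" using m by (simp add: inverse_quads_def)
    finally have "k * y * (l div y) \<le> N" .
    moreover have "1 * 1 < k * y"
      using pos by (intro mult_le_less_imp_less) auto
    moreover have "l div y > 0"
      using pos \<open>y \<le> l\<close> by (simp add: div_greater_zero_iff)
    ultimately show "(x, y, k, l div y) \<in> divisor_quads N"
      using m pos by (auto simp: divisor_quads_def inverse_quads_def)
  qed
  note fin = finite_divisor_quads[of "N"]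
  show "finite ?A" by (rule inj_on_finite[OF inj sub fin])
  show "card ?A \<le> card (divisor_quads N)" by (rule card_inj_on_le[OF inj sub fin])
qed

text \<open>Both quotients vanish, so the last entry is the constant 1. The bound
  \<open>k * y \<le> 2 * (k * l)\<close> is the source of \<open>2 * N\<close>.\<close>

lemma small_inverse_quads:
  shows "finite {(x, y, k, l) \<in> inverse_quads N. k < x \<and> l < y \<and> y \<le> 2 * l}" (is "finite ?A")
    and "card {(x, y, k, l) \<in> inverse_quads N. k < x \<and> l < y \<and> y \<le> 2 * l} \<le> card (divisor_quads (2 * N))"
proof -
  let ?F = "\<lambda>(x, y, k, l). (x, y, k, 1) :: nat \<times> nat \<times> nat \<times> nat"
  have inj: "inj_on ?F ?A"
    by (rule inj_on_inverse_quads[where N = N]) auto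
  have sub: "?F ` ?A \<subseteq> divisor_quads (2 * N)"
  proof clarify
    fix x y k l assume m: "(x, y, k, l) \<in> inverse_quads N" and "k < x" "l < y" "y \<le> 2 * l"
    note pos = inverse_quads_pos[OF m]
    have "k * y \<le> k * (2 * l)" using \<open>y \<le> 2 * l\<close> by simp
    also have "\<dots> \<le> 2 * N" using m by (simp add: inverse_quads_def)
    finally have "k * y * 1 \<le> 2 * N" by simp
    moreover have "1 * 1 < k * y"
      using pos by (intro mult_le_less_imp_less) auto
    ultimately show "(x, y, k, 1) \<in> divisor_quads (2 * N)"
      using m pos by (auto simp: divisor_quads_def inverse_quads_def)
  qed
  note fin = finite_divisor_quads[of "2 * N"]
  show "finite ?A" by (rule inj_on_finite[OF inj sub fin])
  show "card ?A \<le> card (divisor_quads (2 * N))" by (rule card_inj_on_le[OF inj sub fin])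
qed

text \<open>Since \<open>k * y + l * x\<close> is congruent to \<open>1\<close> modulo \<open>x * y\<close>, it exceeds \<open>x * y\<close>.\<close>

lemma inverse_quads_half_large:
  assumes m: "(x, y, k, l) \<in> inverse_quads N"
  shows "x \<le> 2 * k \<or> y \<le> 2 * l"
proof -
  note pos = inverse_quads_pos[OF m]
  have c: "[k * y = 1] (mod x)" "[l * x = 1] (mod y)"
    using m by (auto simp: inverse_quads_def)
  have "coprime x y"
    using c(1) coprime_iff_invertible_nat[of y x] by (auto simp: coprime_commute mult.commute)
  moreover have "[k * y + l * x = 1] (mod x)" "[k * y + l * x = 1] (mod y)"
    using c by (auto simp: cong_def)
  ultimately have "[k * y + l * x = 1] (mod x * y)"
    by (rule coprime_cong_mult_nat[rotated 2])
  then have "x * y dvd k * y + l * x - 1"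
    by (rule cong_to_1_nat)
  moreover have "1 * 1 < k * y"
    using pos by (intro mult_le_less_imp_less) auto
  ultimately have "x * y < k * y + l * x"
    using dvd_imp_le[of "x * y" "k * y + l * x - 1"] by auto
  then have "2 * (x * y) < (2 * k) * y + (2 * l) * x" by simp
  moreover have "(2 * k) * y + (2 * l) * x \<le> x * y + y * x" if "2 * k \<le> x" "2 * l \<le> y"
    using that by (intro add_mono mult_le_mono) auto
  ultimately show ?thesis by (smt (verit) mult.commute mult_2 nat_le_linear not_le)
qed

text \<open>Up to swapping, three cases cover everything: one large, two mixed and two small
  classes. Each mixed or small class costs four sets of bounded quadruples, whence
  \<open>9 = 1 + 2 * 4\<close> and \<open>8 = 2 * 4\<close>.\<close>

lemma finite_inverse_quads: "finite (inverse_quads N)"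
  and card_inverse_quads_le:
    "card (inverse_quads N) \<le> 9 * card (bounded_quads N) + 8 * card (bounded_quads (2 * N))"
proof -
  let ?s = "\<lambda>(x, y, k, l). (y, x, l, k) :: nat \<times> nat \<times> nat \<times> nat"
  let ?A = "{(x, y, k, l) \<in> inverse_quads N. x \<le> k \<and> y \<le> l}"
  let ?B = "{(x, y, k, l) \<in> inverse_quads N. k < x \<and> y \<le> l}"
  let ?C = "{(x, y, k, l) \<in> inverse_quads N. k < x \<and> l < y \<and> y \<le> 2 * l}"
  have cover: "inverse_quads N \<subseteq> ?A \<union> (?B \<union> ?s ` ?B) \<union> (?C \<union> ?s ` ?C)"
  proof
    fix p assume p: "p \<in> inverse_quads N"
    obtain x y k l where pe: "p = (x, y, k, l)" by (cases p) auto
    have s: "p = ?s (y, x, l, k)" "(y, x, l, k) \<in> inverse_quads N"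
      using p inverse_quads_swap pe by auto
    have h: "x \<le> 2 * k \<or> y \<le> 2 * l"
      using inverse_quads_half_large p pe by blast
    consider "x \<le> k" "y \<le> l" | "k < x" "y \<le> l" | "l < y" "x \<le> k"
      | "k < x" "l < y" "y \<le> 2 * l" | "k < x" "l < y" "x \<le> 2 * k"
      using h by linarith
    then show "p \<in> ?A \<union> (?B \<union> ?s ` ?B) \<union> (?C \<union> ?s ` ?C)"
    proof cases
      case 1 then show ?thesis using p pe by auto
    next
      case 2 then show ?thesis using p pe by auto
    next
      case 3
      then have "(y, x, l, k) \<in> ?B" using s by auto
      then have "p \<in> ?s ` ?B" using s(1) by (rule image_eqI[rotated])
      then show ?thesis by blast
    next
      case 4 then show ?thesis using p pe by auto
    next
      case 5
      then have "(y, x, l, k) \<in> ?C" using s by auto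
      then have "p \<in> ?s ` ?C" using s(1) by (rule image_eqI[rotated])
      then show ?thesis by blast
    qed
  qed
  note fin = large_inverse_quads(1)[of N] mixed_inverse_quads(1)[of N] small_inverse_quads(1)[of N]
  show "finite (inverse_quads N)"
    using fin by (intro finite_subset[OF cover]) simp
  have "card (inverse_quads N) \<le> card (?A \<union> (?B \<union> ?s ` ?B) \<union> (?C \<union> ?s ` ?C))"
    using fin cover by (intro card_mono) auto
  also have "\<dots> \<le> card ?A + (card ?B + card (?s ` ?B)) + (card ?C + card (?s ` ?C))"
    by (intro order_trans[OF card_Un_le] add_mono card_Un_le order_refl)
  also have "\<dots> \<le> card ?A + (card ?B + card ?B) + (card ?C + card ?C)"
    using fin by (intro add_mono card_image_le order_refl)
  also have "\<dots> \<le> 9 * card (bounded_quads N) + 8 * card (bounded_quads (2 * N))"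
    using large_inverse_quads(2)[of N] mixed_inverse_quads(2)[of N] small_inverse_quads(2)[of N]
      card_divisor_quads_le[of N] card_divisor_quads_le[of "2 * N"] by linarith
  finally show "card (inverse_quads N) \<le> 9 * card (bounded_quads N) + 8 * card (bounded_quads (2 * N))" .
qed

section \<open>Solutions correspond to inverse quadruples\<close>

text \<open>After clearing denominators \<open>y\<close> divides the product of the two numerators,
  and it is coprime to \<open>Y * y + 1\<close>.\<close>

lemma dvd_of_sols:
  assumes s: "((X, x), (Y, y)) \<in> sols n"
  shows "y dvd X * x + 1"
proof -
  have "coprime y (Y * y + 1)"
    by (metis coprime_1_right coprime_iff_gcd_eq_1 gcd_add_mult add.commute)
  moreover have "y dvd (X * x + 1) * (Y * y + 1)"
    using sols_nat_eq[OF s] by (metis dvd_triv_right mult.assoc)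
  ultimately show ?thesis
    using coprime_dvd_mult_left_iff by blast
qed

text \<open>Multiplying the two defining equations gives
  \<open>k * l * (x * y) = n * (x * y)\<close>, so \<open>k * l = n\<close>.\<close>

lemma inverse_quads_of_sols:
  assumes s: "((X, x), (Y, y)) \<in> sols n" and "n \<le> N"
  defines "k \<equiv> (X * x + 1) div y" and "l \<equiv> (Y * y + 1) div x"
  shows "(x, y, k, l) \<in> inverse_quads N" "k * y = X * x + 1" "l * x = Y * y + 1"
proof -
  have pos: "x > 1" "y > 1" using s by (auto simp: sols_def)
  show eqs: "k * y = X * x + 1" "l * x = Y * y + 1"
    unfolding k_def l_def using dvd_of_sols[OF s] dvd_of_sols[of Y y X x n] swap_sols[OF s]
    by simp_all
  have "(k * l) * (x * y) = (k * y) * (l * x)" by (simp add: mult_ac)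
  also have "\<dots> = n * (x * y)" unfolding eqs sols_nat_eq[OF s] ..
  finally have "k * l = n" using pos by simp
  moreover have "[k * y = 1] (mod x)" "[l * x = 1] (mod y)"
    unfolding eqs by (simp_all only: cong_add_rcancel_0_nat cong_mult_self_right)
  ultimately show "(x, y, k, l) \<in> inverse_quads N"
    using pos \<open>n \<le> N\<close> by (auto simp: inverse_quads_def)
qed

lemma sols_of_inverse_quads:
  assumes m: "(x, y, k, l) \<in> inverse_quads N"
  defines "X \<equiv> (k * y - 1) div x" and "Y \<equiv> (l * x - 1) div y"
  shows "((X, x), (Y, y)) \<in> sols (k * l)" "k * y = X * x + 1" "l * x = Y * y + 1"
proof -
  note pos = inverse_quads_pos[OF m]
  have c: "[k * y = 1] (mod x)" "[l * x = 1] (mod y)"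
    using m by (auto simp: inverse_quads_def)
  have gt: "1 * 1 < k * y" "1 * 1 < l * x"
    using pos by (intro mult_le_less_imp_less; simp)+
  show eqs: "k * y = X * x + 1" "l * x = Y * y + 1"
    using cong_to_1_nat[OF c(1)] cong_to_1_nat[OF c(2)] gt by (auto simp: X_def Y_def)
  have XY: "X > 0" "Y > 0" using eqs gt by (auto intro!: gr0I)
  have "real k * real y = real X * real x + 1" "real l * real x = real Y * real y + 1"
    using eqs by (metis of_nat_1 of_nat_add of_nat_mult)+
  then have kl: "real k = (real X * real x + 1) / real y" "real l = (real Y * real y + 1) / real x"
    using pos by (auto simp: field_simps)
  have "real (k * l) = (real X + 1 / real x) * (real Y + 1 / real y)"
    unfolding of_nat_mult kl using pos by (simp add: field_simps)
  then show "((X, x), (Y, y)) \<in> sols (k * l)"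
    using pos XY by (auto simp: sols_def)
qed

text \<open>The passages between \<open>(X, Y)\<close> and \<open>(k, l)\<close> are mutually
  inverse, and a solution determines its \<open>n\<close>, so the sets for different
  \<open>n\<close> are disjoint.\<close>

lemma sum_num_sols:
  "(\<Sum>n = 1..N. num_sols n) = card {(x, y, k, l) \<in> inverse_quads N. x < y}"
proof -
  let ?O = "\<lambda>n. {((X, x), (Y, y)). ((X, x), (Y, y)) \<in> sols n \<and> x < y}"
  let ?I = "{(x, y, k, l) \<in> inverse_quads N. x < y}"
  let ?g = "\<lambda>(x, y, k, l). (((k * y - 1) div x, x), ((l * x - 1) div y, y)) :: (nat \<times> nat) \<times> nat \<times> nat"
  let ?h = "\<lambda>((X, x), (Y, y)). (x, y, (X * x + 1) div y, (Y * y + 1) div x) :: nat \<times> nat \<times> nat \<times> nat"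
  have "bij_betw ?g ?I (\<Union>n\<in>{1..N}. ?O n)"
  proof (rule bij_betw_byWitness[where f' = ?h])
    show "\<forall>p\<in>?I. ?h (?g p) = p"
    proof clarsimp
      fix x y k l assume m: "(x, y, k, l) \<in> inverse_quads N"
      show "Suc ((k * y - Suc 0) div x * x) div y = k \<and> Suc ((l * x - Suc 0) div y * y) div x = l"
        using sols_of_inverse_quads(2,3)[OF m] inverse_quads_pos[OF m]
        by (metis One_nat_def Suc_eq_plus1 nonzero_mult_div_cancel_right not_less_zero)
    qed
    show "\<forall>p\<in>(\<Union>n\<in>{1..N}. ?O n). ?g (?h p) = p"
    proof clarsimp
      fix X x Y y n assume "((X, x), (Y, y)) \<in> sols n" "n \<le> N"
      from inverse_quads_of_sols(2,3)[OF this] inverse_quads_pos[OF inverse_quads_of_sols(1)[OF this]]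
      show "(Suc (X * x) div y * y - Suc 0) div x = X \<and> (Suc (Y * y) div x * x - Suc 0) div y = Y"
        by simp
    qed
    show "?g ` ?I \<subseteq> (\<Union>n\<in>{1..N}. ?O n)"
    proof clarify
      fix x y k l assume m: "(x, y, k, l) \<in> inverse_quads N" and "x < y"
      have "k * l \<in> {1..N}"
        using m inverse_quads_pos[OF m] by (simp add: inverse_quads_def)
      moreover have "?g (x, y, k, l) \<in> ?O (k * l)"
        using sols_of_inverse_quads(1)[OF m] \<open>x < y\<close> by simp
      ultimately show "(((k * y - 1) div x, x), ((l * x - 1) div y, y)) \<in> (\<Union>n\<in>{1..N}. ?O n)"
        by auto
    qed
    show "?h ` (\<Union>n\<in>{1..N}. ?O n) \<subseteq> ?I"
      using inverse_quads_of_sols(1) by fastforce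
  qed
  then have "card ?I = card (\<Union>n\<in>{1..N}. ?O n)"
    by (rule bij_betw_same_card)
  also have "\<dots> = (\<Sum>n = 1..N. card (?O n))"
  proof (rule card_UN_disjoint)
    show "\<forall>n\<in>{1..N}. finite (?O n)"
      by (auto intro: finite_subset[OF _ finite_sols])
    show "\<forall>n\<in>{1..N}. \<forall>m\<in>{1..N}. n \<noteq> m \<longrightarrow> ?O n \<inter> ?O m = {}"
    proof -
      have "real n = real m" if "((X, x), (Y, y)) \<in> sols n" "((X, x), (Y, y)) \<in> sols m" for X x Y y n m
        using that by (simp add: sols_def)
      then show ?thesis by auto
    qed
  qed simp
  finally show ?thesis by (simp add: num_sols_eq_card_ordered)
qed

section \<open>Lower bound from coprime pairs\<close>

text \<open>The reduced inverse of \<open>y\<close> modulo \<open>x\<close>, shifted by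
  \<open>x * (s - 1)\<close>, lies in the \<open>s\<close>-th block of length \<open>x\<close>;
  blocks are numbered from 1.\<close>

lemma ex_inverse_between:
  fixes x y s :: nat
  assumes "coprime x y" "x > 0" "s > 0"
  shows "\<exists>k. [k * y = 1] (mod x) \<and> k div x = s - 1 \<and> k \<le> x * s"
proof -
  obtain k0 where k0: "[y * k0 = 1] (mod x)"
    using cong_solve_coprime_nat[of y x] assms(1) by (auto simp: coprime_commute)
  let ?k = "k0 mod x + x * (s - 1)"
  have "[?k = k0] (mod x)" by (simp add: cong_def)
  then have "[?k * y = k0 * y] (mod x)" by (rule cong_scalar_right)
  then have "[?k * y = 1] (mod x)" using k0 by (metis cong_trans mult.commute)
  moreover have "?k div x = s - 1" using assms by simp
  moreover have "?k \<le> x * (s - 1) + x" using assms by (simp add: less_imp_le)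
  moreover have "x * (s - 1) + x = x * s" using assms by (cases s) auto
  ultimately show ?thesis by metis
qed

definition coprime_pairs :: "nat \<Rightarrow> (nat \<times> nat) set" where
  "coprime_pairs Z = {(x, y) \<in> {1..Z} \<times> {1..Z}. coprime x y}"

text \<open>Reading off the pair and the block numbers of \<open>k\<close> and \<open>l\<close> maps
  the inverse quadruples onto a set containing all \<open>(x, y, s, t)\<close> counted on the
  left.\<close>

lemma card_ordered_inverse_quads_ge:
  assumes Z: "Z ^ 3 \<le> N"
  shows "(\<Sum>(x, y)\<in>{(x, y) \<in> coprime_pairs Z. 1 < x \<and> x < y}. \<Sum>s = 1..Z. N div (x * y * s))
    \<le> card {(x, y, k, l) \<in> inverse_quads N. x < y}" (is "(\<Sum>(x, y)\<in>?C. _) \<le> card ?I")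
proof -
  let ?S = "SIGMA (x, y) : ?C. SIGMA s : {1..Z}. {1..N div (x * y * s)}"
  let ?f = "\<lambda>(x, y, k, l). ((x, y), (k div x + 1, l div y + 1)) :: (nat \<times> nat) \<times> nat \<times> nat"
  have fin: "finite ?C"
    by (rule finite_subset[of _ "{1..Z} \<times> {1..Z}"]) (auto simp: coprime_pairs_def)
  have "card ?S = (\<Sum>(x, y)\<in>?C. \<Sum>s = 1..Z. N div (x * y * s))"
    using fin by (subst card_SigmaI) (auto intro!: sum.cong)
  moreover have "card ?S \<le> card ?I"
  proof (rule surj_card_le)
    show "finite ?I" by (rule finite_subset[OF _ finite_inverse_quads]) auto
    show "?S \<subseteq> ?f ` ?I"
    proof
      fix p assume "p \<in> ?S"
      then obtain x y s t where p: "p = ((x, y), (s, t))"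
        and xy: "coprime x y" "1 < x" "x < y" and st: "s > 0" "t > 0"
        and le: "t \<le> N div (x * y * s)"
        by (auto simp: coprime_pairs_def)
      obtain k where k: "[k * y = 1] (mod x)" "k div x = s - 1" "k \<le> x * s"
        using ex_inverse_between[of x y s] xy st by auto
      obtain l where l: "[l * x = 1] (mod y)" "l div y = t - 1" "l \<le> y * t"
        using ex_inverse_between[of y x t] xy st by (auto simp: coprime_commute)
      have "k * l \<le> (x * s) * (y * t)" using k l by (intro mult_le_mono)
      also have "\<dots> \<le> N"
        using le xy st by (simp add: less_eq_div_iff_mult_less_eq mult_ac)
      finally have "(x, y, k, l) \<in> ?I" using k l xy by (auto simp: inverse_quads_def)
      moreover have "p = ?f (x, y, k, l)" using p k l st by simp
      ultimately show "p \<in> ?f ` ?I" by (rule image_eqI[rotated])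
    qed
  qed
  ultimately show ?thesis by simp
qed

lemma sum_inverse_squares_le: "(\<Sum>g = 1..Z. 1 / real g ^ 2) \<le> 2"
proof -
  \<comment> \<open>The bound is sharpened by \<open>1 / n\<close> so that the induction
    telescopes.\<close>
  have "(\<Sum>g = 1..n. 1 / real g ^ 2) \<le> 2 - 1 / real n" if "n > 0" for n
    using that
  proof (induction n rule: nat_induct_non_zero)
    case (Suc n)
    have "1 / real (Suc n) ^ 2 \<le> 1 / (real n * real (Suc n))"
      using Suc.hyps by (intro divide_left_mono) (auto simp: power2_eq_square)
    also have "\<dots> = 1 / real n - 1 / real (Suc n)"
      using Suc.hyps by (simp add: field_simps)
    finally have "1 / real (Suc n) ^ 2 \<le> 1 / real n - 1 / real (Suc n)" .
    then show ?case using Suc by simp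
  qed simp
  from this[of Z] show ?thesis by (cases "Z = 0") (auto intro: order_trans)
qed

text \<open>Dividing a pair by its gcd \<open>g\<close> scales the weight \<open>1 / (x * y)\<close> by \<open>g\<^sup>2\<close>, and
  \<open>\<Sum> 1 / g\<^sup>2 \<le> 2\<close>, so coprime pairs carry at least half of the total weight.\<close>

lemma sum_coprime_pairs_ge:
  "harm Z ^ 2 / 2 \<le> (\<Sum>(x, y)\<in>coprime_pairs Z. 1 / (real x * real y))"
proof -
  let ?P = "{1..Z} \<times> {1..Z}"
  let ?w = "\<lambda>(x, y). 1 / (real x * real y)"
  let ?v = "\<lambda>(g, p). 1 / real g ^ 2 * ?w p"
  let ?f = "\<lambda>(x, y). (gcd x y, (x div gcd x y, y div gcd x y))"
  have fin: "finite (coprime_pairs Z)"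
    by (rule finite_subset[of _ ?P]) (auto simp: coprime_pairs_def)
  have inj: "inj_on ?f ?P"
    by (rule inj_onI) (auto, (metis dvd_div_mult_self gcd_dvd1 gcd_dvd2)+)
  have sub: "?f ` ?P \<subseteq> {1..Z} \<times> coprime_pairs Z"
  proof (rule image_subsetI)
    fix p assume "p \<in> ?P"
    then obtain x y where p: "p = (x, y)" and *: "x \<in> {1..Z}" "y \<in> {1..Z}" by blast
    then have *: "x > 0" "y > 0" "x \<le> Z" "y \<le> Z" by auto
    then have "gcd x y \<le> Z" by (meson dvd_imp_le gcd_dvd1 le_trans)
    moreover have "x div gcd x y \<le> Z" "y div gcd x y \<le> Z"
      using *(3,4) div_le_dividend le_trans by blast+
    moreover have "x div gcd x y > 0" "y div gcd x y > 0"
      using * by (auto simp: div_greater_zero_iff dvd_imp_le)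
    moreover have "coprime (x div gcd x y) (y div gcd x y)"
      using * by (intro div_gcd_coprime) auto
    ultimately show "?f p \<in> {1..Z} \<times> coprime_pairs Z"
      using * p by (auto simp: coprime_pairs_def Suc_le_eq)
  qed
  have "harm Z ^ 2 = (\<Sum>p\<in>?P. ?w p)"
    by (simp add: harm_def power2_eq_square sum_product field_simps flip: sum.cartesian_product)
  also have "\<dots> = (\<Sum>p\<in>?P. ?v (?f p))"
  proof (rule sum.cong[OF refl])
    fix p assume "p \<in> ?P"
    then show "?w p = ?v (?f p)"
      by (auto simp: real_of_nat_div power2_eq_square)
  qed
  also have "\<dots> = (\<Sum>q\<in>?f ` ?P. ?v q)"
    using inj by (simp add: sum.reindex)
  \<comment> \<open>Passing from the image to the full product adds only nonnegative terms and
    separates the variables.\<close>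
  also have "\<dots> \<le> (\<Sum>q\<in>{1..Z} \<times> coprime_pairs Z. ?v q)"
    using sub fin by (intro sum_mono2) auto
  also have "\<dots> = (\<Sum>g = 1..Z. 1 / real g ^ 2) * (\<Sum>p\<in>coprime_pairs Z. ?w p)"
    by (simp add: sum_product sum.cartesian_product)
  also have "\<dots> \<le> 2 * (\<Sum>p\<in>coprime_pairs Z. ?w p)"
    by (intro mult_right_mono sum_inverse_squares_le sum_nonneg) auto
  finally show ?thesis by simp
qed

text \<open>A coprime pair is increasing, decreasing or has a coordinate 1, as equal coordinates
  must be 1. Pairs with a coordinate 1 weigh at most \<open>2 * harm Z\<close>, and symmetry halves
  the rest.\<close>

lemma sum_ordered_coprime_pairs_ge:
  "harm Z ^ 2 / 4 - harm Z \<le>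
     (\<Sum>(x, y)\<in>{(x, y) \<in> coprime_pairs Z. 1 < x \<and> x < y}. 1 / (real x * real y))"
proof -
  let ?w = "\<lambda>(x, y). 1 / (real x * real y)"
  let ?C = "{(x, y) \<in> coprime_pairs Z. 1 < x \<and> x < y}"
  let ?E = "{1} \<times> {1..Z}"
  have Un: "sum ?w (A \<union> B) \<le> sum ?w A + sum ?w B" if "finite A" "finite B" for A B
    using that sum.union_inter[of A B ?w] sum_nonneg[of "A \<inter> B" ?w] by (simp add: split_def)
  have swap: "sum ?w (prod.swap ` A) = sum ?w A" for A
    by (subst sum.reindex) (auto simp: split_def mult.commute intro!: sum.cong)
  have fin: "finite ?C"
    by (rule finite_subset[of _ "{1..Z} \<times> {1..Z}"]) (auto simp: coprime_pairs_def)
  have "coprime_pairs Z \<subseteq> (?C \<union> prod.swap ` ?C) \<union> (?E \<union> prod.swap ` ?E)"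
  proof
    fix p assume "p \<in> coprime_pairs Z"
    then obtain x y where p: "p = (x, y)" and m: "(x, y) \<in> coprime_pairs Z" by (cases p) auto
    then have m': "coprime x y" "x \<in> {1..Z}" "y \<in> {1..Z}" "(y, x) \<in> coprime_pairs Z"
      by (auto simp: coprime_pairs_def coprime_commute)
    have swap: "p \<in> prod.swap ` A \<longleftrightarrow> (y, x) \<in> A" for A
      unfolding p by force
    consider "x = 1" | "y = 1" | "1 < x" "x < y" | "1 < y" "y < x" | "x = y" "x \<noteq> 1"
      using m'(2,3) by fastforce
    then show "p \<in> (?C \<union> prod.swap ` ?C) \<union> (?E \<union> prod.swap ` ?E)"
      unfolding Un_iff swap using m m' p by cases auto
  qed
  then have "(\<Sum>p\<in>coprime_pairs Z. ?w p) \<le> sum ?w ((?C \<union> prod.swap ` ?C) \<union> (?E \<union> prod.swap ` ?E))"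
    using fin by (intro sum_mono2) auto
  also have "\<dots> \<le> (sum ?w ?C + sum ?w (prod.swap ` ?C)) + (sum ?w ?E + sum ?w (prod.swap ` ?E))"
    using fin by (intro order_trans[OF Un] add_mono Un) auto
  also have "\<dots> = 2 * sum ?w ?C + 2 * sum ?w ?E" unfolding swap by simp
  also have "sum ?w ?E = harm Z"
    by (simp add: harm_def inverse_eq_divide flip: sum.cartesian_product)
  finally show ?thesis using sum_coprime_pairs_ge[of Z] by (simp add: field_simps)
qed

text \<open>As \<open>x * y * s \<le> Z ^ 3 \<le> N\<close>, each quotient is at least 1, so
  rounding loses at most a factor 2. This and the 1/4 for ordered pairs give the 1/8.\<close>

lemma sum_num_sols_ge:
  assumes Z: "Z ^ 3 \<le> N"
  shows "real N / 8 * harm Z ^ 2 * (harm Z - 4) \<le> real (\<Sum>n = 1..N. num_sols n)"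
proof -
  let ?C = "{(x, y) \<in> coprime_pairs Z. 1 < x \<and> x < y}"
  have div: "real N / 2 * ((1 / (real x * real y)) * (1 / real s)) \<le> real (N div (x * y * s))"
    if "(x, y) \<in> ?C" "s \<in> {1..Z}" for x y s
  proof -
    let ?m = "x * y * s"
    have m: "?m > 0" "x \<le> Z" "y \<le> Z" "s \<le> Z" using that by (auto simp: coprime_pairs_def)
    then have "?m \<le> Z * Z * Z" by (intro mult_le_mono)
    then have "?m \<le> N" using Z by (simp add: power3_eq_cube)
    then have "N div ?m > 0" using m by (simp add: div_greater_zero_iff)
    moreover have "N < ?m * (N div ?m) + ?m"
      using mod_less_divisor[OF m(1), of N] mult_div_mod_eq[of ?m N] by linarith
    ultimately have "N \<le> 2 * (?m * (N div ?m))"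
      using mult_le_mono2[of 1 "N div ?m" ?m] by linarith
    then have "real N \<le> 2 * (real ?m * real (N div ?m))"
      by (metis of_nat_le_iff of_nat_mult of_nat_numeral)
    then have "real N / (2 * real ?m) \<le> real (N div ?m)"
      using m(1) by (simp add: divide_simps mult_ac del: of_nat_mult)
    then show ?thesis by simp
  qed
  have "real N / 8 * harm Z ^ 2 * (harm Z - 4) = real N / 2 * ((harm Z ^ 2 / 4 - harm Z) * harm Z)"
    by (simp add: field_simps power2_eq_square)
  also have "\<dots> \<le> real N / 2 * ((\<Sum>(x, y)\<in>?C. 1 / (real x * real y)) * harm Z)"
    by (intro mult_left_mono mult_right_mono sum_ordered_coprime_pairs_ge harm_nonneg) auto
  also have "\<dots> = (\<Sum>(x, y)\<in>?C. \<Sum>s = 1..Z. real N / 2 * ((1 / (real x * real y)) * (1 / real s)))"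
    unfolding sum_distrib_right sum_distrib_left
    by (simp add: harm_def sum_distrib_left split_def inverse_eq_divide)
  also have "\<dots> \<le> (\<Sum>(x, y)\<in>?C. \<Sum>s = 1..Z. real (N div (x * y * s)))"
    using div by (intro sum_mono) (auto intro!: sum_mono)
  also have "\<dots> = real (\<Sum>(x, y)\<in>?C. \<Sum>s = 1..Z. N div (x * y * s))"
    by (simp add: split_def)
  also have "\<dots> \<le> real (\<Sum>n = 1..N. num_sols n)"
    unfolding sum_num_sols using card_ordered_inverse_quads_ge[OF Z] by (rule of_nat_mono)
  finally show ?thesis .
qed

section \<open>Final estimates and constants\<close>

lemma sum_num_sols_le:
  "real (\<Sum>n = 1..N. num_sols n) \<le> 9 * (N * harm N ^ 3) + 16 * (N * harm (2 * N) ^ 3)"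
proof -
  have "(\<Sum>n = 1..N. num_sols n) \<le> card (inverse_quads N)"
    unfolding sum_num_sols by (intro card_mono finite_inverse_quads) auto
  also note card_inverse_quads_le
  finally have "real (\<Sum>n = 1..N. num_sols n)
      \<le> real (9 * card (bounded_quads N) + 8 * card (bounded_quads (2 * N)))"
    by (rule of_nat_mono)
  then have "real (\<Sum>n = 1..N. num_sols n)
      \<le> 9 * real (card (bounded_quads N)) + 8 * real (card (bounded_quads (2 * N)))"
    by (simp only: of_nat_add of_nat_mult of_nat_numeral)
  then show ?thesis
    using card_bounded_quads_le[of N] card_bounded_quads_le[of "2 * N"] by simp
qed

lemma sum_num_sols_pos:
  assumes "N \<ge> 2" shows "(\<Sum>n = 1..N. num_sols n) \<ge> 1"
proof -
  \<comment> \<open>This encodes \<open>2 = (1 + 1/2) * (1 + 1/3)\<close>.\<close>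
  have "(2, 3, 1, 2) \<in> {(x, y, k, l) \<in> inverse_quads N. x < y}"
    using assms by (auto simp: inverse_quads_def cong_def)
  moreover have "finite {(x, y, k, l) \<in> inverse_quads N. x < y}"
    by (rule finite_subset[OF _ finite_inverse_quads]) auto
  ultimately have "card {(x, y, k, l) \<in> inverse_quads N. x < y} > 0"
    unfolding card_gt_0_iff by blast
  then show ?thesis unfolding sum_num_sols by simp
qed

theorem theorem4:
  "\<exists>C1 C2 :: real. C1 > 0 \<and> C2 > 0 \<and>
     (\<forall>T :: real. T \<ge> 2 \<longrightarrow>
        C1 < (\<Sum>n | 1 \<le> n \<and> real n \<le> T. real (num_sols n)) / (T * (ln T) ^ 3) \<and>
        (\<Sum>n | 1 \<le> n \<and> real n \<le> T. real (num_sols n)) / (T * (ln T) ^ 3) < C2)"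
proof -
  \<comment> \<open>The second value serves \<open>T < exp 24\<close>, where the sum is only known
    to be at least 1. The first serves larger \<open>T\<close>, where \<open>harm Z \<ge> 8\<close>
    and hence \<open>harm Z - 4 \<ge> harm Z / 2\<close>.\<close>
  define C1 :: real where "C1 = min (1 / 1000) (1 / (exp 24 * 24 ^ 3))"
  have "C1 < S / (T * ln T ^ 3) \<and> S / (T * ln T ^ 3) < 1601"
    if T: "T \<ge> 2" and S: "S = (\<Sum>n | 1 \<le> n \<and> real n \<le> T. real (num_sols n))" for T S :: real
  proof -
    define N where "N = nat \<lfloor>T\<rfloor>"
    have N: "real N \<le> T" "T < real N + 1" "N \<ge> 2"
      using T by (auto simp: N_def le_nat_iff le_floor_iff)
    have "{n. 1 \<le> n \<and> real n \<le> T} = {1..N}"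
      using T by (auto simp: N_def le_nat_iff le_floor_iff)
    then have S: "S = real (\<Sum>n = 1..N. num_sols n)" using S by simp
    have ln: "2 / 3 \<le> ln T"
      using ln2_ge_two_thirds T by (smt (verit) ln_le_cancel_iff)
    have pos: "T * ln T ^ 3 > 0" using T ln by simp
    have "harm (2 * N) \<le> 1 + ln (real (2 * N))" using N by (intro harm_le_ln) simp
    also have "\<dots> = 1 + ln 2 + ln (real N)" using N by (simp add: ln_mult)
    \<comment> \<open>From \<open>2 / 3 \<le> ln T\<close> the constant 1 is at most
      \<open>3 / 2 * ln T\<close>.\<close>
    also have "\<dots> \<le> 4 * ln T"
    proof -
      have "ln (real N) \<le> ln T" "ln 2 \<le> ln T"
        using N T by (auto intro!: ln_mono)
      then show ?thesis using ln by simp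
    qed
    finally have h2: "harm (2 * N) \<le> 4 * ln T" .
    then have h1: "harm N \<le> 4 * ln T"
      using harm_mono[of N "2 * N", where ?'a = real] by simp
    have "S \<le> 9 * (N * harm N ^ 3) + 16 * (N * harm (2 * N) ^ 3)"
      unfolding S by (rule sum_num_sols_le)
    also have "\<dots> \<le> 9 * (T * (4 * ln T) ^ 3) + 16 * (T * (4 * ln T) ^ 3)"
      using N h1 h2 T by (intro add_mono mult_left_mono mult_mono power_mono)
        (auto intro: harm_nonneg)
    \<comment> \<open>Here \<open>1600 = (9 + 16) * 4 ^ 3\<close>; the next step raises it by 1 for
      strictness.\<close>
    also have "\<dots> = 1600 * (T * ln T ^ 3)" by (simp add: power_mult_distrib)
    also have "\<dots> < 1601 * (T * ln T ^ 3)" using pos by simp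
    finally have upper: "S / (T * ln T ^ 3) < 1601" using pos by (simp add: divide_less_eq)
    have "C1 * (T * ln T ^ 3) < S"
    proof (cases "T < exp 24")
      case True
      then have "ln T < 24" using T ln_less_cancel_iff[of T "exp 24"] by simp
      then have "ln T ^ 3 \<le> 24 ^ 3" using ln by (intro power_mono) auto
      then have "T * ln T ^ 3 < exp 24 * 24 ^ 3"
        using True ln T by (intro mult_less_le_imp_less) auto
      then have "1 / (exp 24 * 24 ^ 3) * (T * ln T ^ 3) < 1" by (simp add: field_simps)
      moreover have "C1 * (T * ln T ^ 3) \<le> 1 / (exp 24 * 24 ^ 3) * (T * ln T ^ 3)"
        using pos by (intro mult_right_mono) (auto simp: C1_def)
      moreover have "1 \<le> S" unfolding S using sum_num_sols_pos[OF N(3)] by linarith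
      ultimately show ?thesis by linarith
    next
      case False
      \<comment> \<open>The integer cube root satisfies \<open>Z ^ 3 \<le> N\<close> while
        \<open>harm Z\<close> keeps a third of \<open>ln T\<close>.\<close>
      define Z where "Z = nat \<lfloor>T powr (1 / 3)\<rfloor>"
      have Z: "real Z \<le> T powr (1 / 3)" "T powr (1 / 3) < real Z + 1"
        by (auto simp: Z_def)
      have "real Z ^ 3 \<le> (T powr (1 / 3)) ^ 3" using Z by (intro power_mono) auto
      also have "\<dots> = T" using T by (simp add: powr_power)
      finally have "Z ^ 3 \<le> N"
        unfolding N_def by (intro le_nat_floor) simp
      have "ln T / 3 = ln (T powr (1 / 3))" using T by (simp add: ln_powr)
      also have "\<dots> \<le> ln (real Z + 1)"
        using Z T by (intro ln_mono) auto
      also have "\<dots> \<le> harm Z" by (rule ln_le_harm)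
      finally have H: "ln T / 3 \<le> harm Z" .
      have "ln T \<ge> 24" using False T by (metis ln_exp ln_mono exp_gt_zero not_less)
      then have H8: "harm Z \<ge> (8 :: real)" using H by simp
      have "C1 * (T * ln T ^ 3) \<le> 1 / 1000 * (T * ln T ^ 3)"
        using pos by (intro mult_right_mono) (auto simp: C1_def)
      \<comment> \<open>The value is \<open>864 = 32 * 3 ^ 3\<close>.\<close>
      also have "\<dots> < 1 / 864 * (T * ln T ^ 3)" using pos by simp
      also have "\<dots> = T / 32 * (ln T / 3) ^ 3" by (simp add: power_divide)
      \<comment> \<open>\<open>T < N + 1\<close> gives \<open>T \<le> 2 * N\<close>.\<close>
      also have "\<dots> \<le> (2 * real N) / 32 * harm Z ^ 3"
        using N H ln by (intro mult_mono power_mono) auto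
      also have "\<dots> = real N / 8 * harm Z ^ 2 * (harm Z / 2)"
        by (simp add: power2_eq_square power3_eq_cube)
      also have "\<dots> \<le> real N / 8 * harm Z ^ 2 * (harm Z - 4)"
        using H8 by (intro mult_left_mono) auto
      also have "\<dots> \<le> S" unfolding S using \<open>Z ^ 3 \<le> N\<close> by (rule sum_num_sols_ge)
      finally show ?thesis .
    qed
    then show ?thesis using upper pos by (simp add: less_divide_eq)
  qed
  moreover have "C1 > 0" by (simp add: C1_def)
  ultimately show ?thesis
    by (intro exI[of _ C1] exI[of _ 1601]) auto
qed

end
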